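(* Let $B_{n,k}$ be the external profile of a random symmetric digital search tree of size $n$, with $k=k(n)$. If $\mathrm{Var}(B_{n,k})\to\infty$ as $n\to\infty$, then the external profile is asymptotically concentrated around its expected value: \[ \frac{B_{n,k}}{\mathbb{E}(B_{n,k})}\stackrel{P}{\longrightarrow}1, \] where $\stackrel{P}{\longrightarrow}$ denotes convergence in probability.
   Context: Random symmetric digital search tree (DST) of size $n$: one is given a sequence of $n$ records, each an infinite string of bits, all bits of all records being independent and uniform on $\{0,1\}$. If $n=0$ the tree is a single external node. If $n\ge1$, the first record is stored in the root (an internal node, at level $0$); the remaining $n-1$ records are distributed, retaining their relative order, to the left or right subtree according as their first bit is $0$ or $1$; the subtrees are built recursively by the same rule, using the next bit at each level. Thus the tree is a binary tree with $n$ internal nodes (holding the records) and $n+1$ external nodes (empty places). External profile: $B_{n,k}$ is the number of external nodes at level (distance from the root) $k$. Equivalently, $B_{0,0}=1$, $B_{0,k}=0$ for $k\ge1$, $B_{n,0}=0$ for $n\ge1$, and for $n,k\ge1$, $B_{n,k}\stackrel{d}{=}B_{J_n,k-1}+B^*_{n-1-J_n,k-1}$, where $J_n$ is Binomial$(n-1,\frac12)$, and $B^*$ is an independent copy of $B$ (both independent of $J_n$). *)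

theory Defs
  imports "HOL-Probability.Probability" "HOL-Library.Tree"
begin

text \<open>
  A record is an infinite bit string, here a function from bit positions to bits, where
  \<^const>\<open>False\<close> is the bit 0 and \<^const>\<open>True\<close> the bit 1.  External nodes are the leaves
  \<^const>\<open>Leaf\<close>, internal nodes carry the stored record.
\<close>

type_synonym record_bits = "nat \<Rightarrow> bool"

text \<open>The first argument is the position of the bit used for splitting at the root of the subtree.\<close>

function dst_from :: "nat \<Rightarrow> record_bits list \<Rightarrow> record_bits tree" where
  "dst_from d [] = Leaf"
| "dst_from d (r # rs) =
     Node (dst_from (Suc d) (filter (\<lambda>s. \<not> s d) rs)) r (dst_from (Suc d) (filter (\<lambda>s. s d) rs))"
  by pat_completeness auto
termination
  by (relation "Wellfounded.measure (\<lambda>(d, rs). length rs)") (auto simp: le_imp_less_Suc)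

definition dst :: "record_bits list \<Rightarrow> record_bits tree" where
  "dst rs = dst_from 0 rs"

fun external_nodes_at :: "'a tree \<Rightarrow> nat \<Rightarrow> nat" where
  "external_nodes_at Leaf 0 = 1"
| "external_nodes_at Leaf (Suc k) = 0"
| "external_nodes_at (Node l x r) 0 = 0"
| "external_nodes_at (Node l x r) (Suc k) = external_nodes_at l k + external_nodes_at r k"

text \<open>\<^term>\<open>b i j \<omega>\<close> is the bit at position \<^term>\<open>j\<close> of the record number \<^term>\<open>i\<close>.\<close>

definition external_profile ::
    "(nat \<Rightarrow> nat \<Rightarrow> 'w \<Rightarrow> bool) \<Rightarrow> nat \<Rightarrow> nat \<Rightarrow> 'w \<Rightarrow> real" where
  "external_profile b n k \<omega> =
     real (external_nodes_at (dst (map (\<lambda>i j. b i j \<omega>) [0..<n])) k)"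

definition symmetric_bits ::
    "'w measure \<Rightarrow> nat \<Rightarrow> (nat \<Rightarrow> nat \<Rightarrow> 'w \<Rightarrow> bool) \<Rightarrow> bool" where
  "symmetric_bits M n b \<longleftrightarrow>
     prob_space.indep_vars M (\<lambda>_. count_space UNIV) (\<lambda>(i, j). b i j) ({..<n} \<times> UNIV) \<and>
     (\<forall>i<n. \<forall>j. distr M (count_space UNIV) (b i j) = measure_pmf (pmf_of_set UNIV))"

text \<open>
  Convergence in probability to a constant, which only involves the individual laws; hence the
  variables may live on different probability spaces.
\<close>

definition tendsto_in_probability ::
    "(nat \<Rightarrow> 'w measure) \<Rightarrow> (nat \<Rightarrow> 'w \<Rightarrow> real) \<Rightarrow> real \<Rightarrow> bool" where
  "tendsto_in_probability M X c \<longleftrightarrow>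
     (\<forall>\<epsilon>>0. (\<lambda>n. measure (M n) {\<omega> \<in> space (M n). \<bar>X n \<omega> - c\<bar> > \<epsilon>}) \<longlonglongrightarrow> 0)"

end

theory Submission imports Defs begin

text \<open>
  The heart of the matter is that the variance of the external profile is at most a constant times its mean,
  uniformly in the size and the level (\<open>variance_external_profile_le\<close>).  If the variance tends to infinity, so
  does the mean, the variance is negligible compared with the square of the mean, and Chebyshev's
  inequality gives the concentration.

  For the variance bound, condition on the sizes \<open>J\<close> and \<open>n - J\<close> of the two subtrees of a tree with \<open>n + 1\<close>
  records.  The variance at level \<open>k + 1\<close> is twice the mean variance of a subtree at level \<open>k\<close>, plus the
  variance of the conditional mean \<open>2 ^ k * (p (J, k) + p (n - J, k))\<close>, where \<open>p (n, k)\<close> is the probability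
  that a fixed node at level \<open>k\<close> is external (\<open>path_prob\<close>).  The mean obeys the same
  recursion without the second term, so it suffices that this term is at most the mean times a summable
  function of \<open>k\<close>.

  The conditional mean is even in the two sizes, so its linear fluctuations cancel, and two applications of
  the Poincare inequality bound its variance by the mean of the squared second difference of \<open>p\<close>, times
  \<open>n\<^sup>2\<close> (\<open>bin_var_symmetrised\<close>).  The second difference is explicit: it
  equals \<open>p (n, k) - 6 p (n, k - 1) + 8 p (n, k - 2)\<close> divided by \<open>4 ^ k\<close>
  (\<open>path_prob_second_difference\<close>).  One of the two factors of its square has to be kept in order to
  compare with \<open>p\<close> itself, and \<open>n\<^sup>2\<close> has to be traded for \<open>4 ^ k\<close>.  For \<open>n\<close> large
  against \<open>2 ^ k\<close> this is possible because \<open>p\<close> decays (\<open>path_prob_decay\<close>), for small \<open>n\<close>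
  because moving down one level reduces \<open>p\<close> by no more than a factor of the order \<open>n / 2 ^ k\<close>
  (\<open>path_prob_insert_level\<close>).  Both facts come from the size bias of the binomial law and lose only
  polynomial factors in \<open>k\<close>, which the remaining \<open>2 ^ (-k)\<close> makes summable
  (\<open>path_prob_curvature\<close>, \<open>variance_profile_law_le\<close>).
\<close>

section \<open>Means and variances under the fair binomial law\<close>

text \<open>
  The expectation of \<open>g J\<close> for \<open>J\<close> binomial with parameters \<open>n\<close> and \<open>1/2\<close>, the law of the size of
  either subtree of a tree with \<open>n + 1\<close> records.
\<close>

definition bin_mean :: "nat \<Rightarrow> (nat \<Rightarrow> real) \<Rightarrow> real" where
  "bin_mean n g = measure_pmf.expectation (binomial_pmf n (1/2)) g"

lemma bin_mean_sum: "bin_mean n g = (\<Sum>j\<le>n. pmf (binomial_pmf n (1/2)) j * g j)"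
  unfolding bin_mean_def by (subst integral_measure_pmf[of "{..n}"]) auto

lemma bin_mean_0 [simp]: "bin_mean 0 g = g 0"
  by (simp add: bin_mean_sum)

lemma bin_mean_Suc:
  "bin_mean (Suc n) g = (bin_mean n g + bin_mean n (\<lambda>j. g (Suc j))) / 2"
proof -
  have *: "binomial_pmf (Suc n) (1/2) =
      bernoulli_pmf (1/2) \<bind> (\<lambda>b. map_pmf (\<lambda>k. (if b then 1 else 0) + k) (binomial_pmf n (1/2)))"
    by (simp add: binomial_pmf_Suc map_pmf_def)
  show ?thesis
    unfolding bin_mean_def *
    by (subst pmf_expectation_bind[of UNIV]) (auto simp: UNIV_bool field_simps)
qed

lemma bin_mean_add: "bin_mean n (\<lambda>j. f j + g j) = bin_mean n f + bin_mean n g"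
  by (simp add: bin_mean_sum sum.distrib distrib_left)

lemma bin_mean_cmult: "bin_mean n (\<lambda>j. c * g j) = c * bin_mean n g"
  by (simp add: bin_mean_sum sum_distrib_left mult_ac)

lemma bin_mean_diff: "bin_mean n (\<lambda>j. f j - g j) = bin_mean n f - bin_mean n g"
  by (simp add: bin_mean_sum sum_subtractf right_diff_distrib)

lemma bin_mean_mono: "(\<And>j. j \<le> n \<Longrightarrow> f j \<le> g j) \<Longrightarrow> bin_mean n f \<le> bin_mean n g"
  unfolding bin_mean_sum by (intro sum_mono mult_left_mono) auto

lemma bin_mean_cong: "(\<And>j. j \<le> n \<Longrightarrow> f j = g j) \<Longrightarrow> bin_mean n f = bin_mean n g"
  unfolding bin_mean_sum by (intro sum.cong) auto

lemma bin_mean_const [simp]: "bin_mean n (\<lambda>_. c) = c"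
  by (simp add: bin_mean_def)

lemma bin_mean_nonneg: "(\<And>j. j \<le> n \<Longrightarrow> 0 \<le> g j) \<Longrightarrow> 0 \<le> bin_mean n g"
  using bin_mean_mono[of n "\<lambda>_. 0" g] by simp

lemma bin_mean_reflect: "bin_mean n (\<lambda>j. g (n - j)) = bin_mean n g"
proof -
  have "bin_mean n g = (\<Sum>j\<le>n. pmf (binomial_pmf n (1/2)) (n - j) * g (n - j))"
    unfolding bin_mean_sum
    by (rule sum.reindex_bij_witness[of _ "\<lambda>j. n - j" "\<lambda>j. n - j"]) auto
  also have "\<dots> = (\<Sum>j\<le>n. pmf (binomial_pmf n (1/2)) j * g (n - j))"
    by (intro sum.cong) (auto simp: binomial_symmetric[symmetric] mult_ac)
  finally show ?thesis
    by (simp add: bin_mean_sum)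
qed

text \<open>
  Weighting a sum of \<open>n + 1\<close> fair coins by its value means choosing one coin, which must then show 1,
  and leaving the other \<open>n\<close> coins unbiased.  Every factor that grows with the number of records is
  absorbed by this identity: a factor \<open>n\<close> outside the mean becomes a factor \<open>j\<close> inside, at the
  price of shifting the argument of \<open>g\<close> by one.
\<close>

lemma bin_mean_size_bias:
  "bin_mean (Suc n) (\<lambda>j. real j * g (j - 1)) = real (Suc n) / 2 * bin_mean n g"
proof (induction n arbitrary: g)
  case 0
  show ?case by (simp add: bin_mean_Suc)
next
  case (Suc n)
  have "bin_mean (Suc (Suc n)) (\<lambda>j. real j * g (j - 1)) =
      (bin_mean (Suc n) (\<lambda>j. real j * g (j - 1)) + bin_mean (Suc n) (\<lambda>j. real (Suc j) * g j)) / 2"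
    by (subst bin_mean_Suc) simp
  also have "bin_mean (Suc n) (\<lambda>j. real (Suc j) * g j) =
      bin_mean (Suc n) (\<lambda>j. real j * g (Suc (j - 1)) + g j)"
    by (rule bin_mean_cong) (auto simp: algebra_simps, metis One_nat_def Suc_pred not_gr0)
  also have "\<dots> = real (Suc n) / 2 * bin_mean n (\<lambda>j. g (Suc j)) + bin_mean (Suc n) g"
    using Suc.IH[of "\<lambda>j. g (Suc j)"] by (simp add: bin_mean_add)
  finally show ?case
    using Suc.IH[of g] by (simp add: bin_mean_Suc field_simps)
qed

lemma bin_mean_size_bias2:
  "bin_mean (Suc (Suc n)) (\<lambda>j. real j * real (j - 1) * g (j - 2)) =
     real (Suc n) * real (Suc (Suc n)) / 4 * bin_mean n g"
proof -
  have "bin_mean (Suc (Suc n)) (\<lambda>j. real j * real (j - 1) * g (j - 2)) =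
      bin_mean (Suc (Suc n)) (\<lambda>j. real j * (real (j - 1) * g (j - 1 - 1)))"
    by (simp add: mult.assoc numeral_2_eq_2)
  also have "\<dots> = real (Suc (Suc n)) / 2 * bin_mean (Suc n) (\<lambda>j. real j * g (j - 1))"
    by (rule bin_mean_size_bias)
  also have "\<dots> = real (Suc (Suc n)) / 2 * (real (Suc n) / 2 * bin_mean n g)"
    by (subst bin_mean_size_bias) (rule refl)
  finally show ?thesis by simp
qed

definition bin_var :: "nat \<Rightarrow> (nat \<Rightarrow> real) \<Rightarrow> real" where
  "bin_var n g = bin_mean n (\<lambda>j. (g j)\<^sup>2) - (bin_mean n g)\<^sup>2"

text \<open>
  The Poincare (Efron--Stein) inequality for fair coins that are seen only through their sum.
  Conditioning on the first coin splits the variance into the mean of two variances with one coin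
  fewer and the squared difference of two means, which Jensen's inequality bounds.
\<close>

lemma bin_var_poincare:
  "bin_var (Suc n) g \<le> real (Suc n) / 4 * bin_mean n (\<lambda>j. (g (Suc j) - g j)\<^sup>2)"
proof (induction n arbitrary: g)
  case 0
  show ?case by (simp add: bin_var_def bin_mean_Suc power2_eq_square field_simps)
next
  case (Suc n)
  let ?\<Delta> = "\<lambda>j. g (Suc j) - g j"
  have jensen: "(bin_mean (Suc n) ?\<Delta>)\<^sup>2 \<le> bin_mean (Suc n) (\<lambda>j. (?\<Delta> j)\<^sup>2)"
  proof -
    let ?m = "bin_mean (Suc n) ?\<Delta>"
    have "0 \<le> bin_mean (Suc n) (\<lambda>j. (?\<Delta> j - ?m)\<^sup>2)"
      by (rule bin_mean_nonneg) simp
    also have "\<dots> = bin_mean (Suc n) (\<lambda>j. (?\<Delta> j)\<^sup>2 + (?m\<^sup>2 - 2 * ?m * ?\<Delta> j))"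
      by (rule bin_mean_cong) (simp add: power2_eq_square algebra_simps)
    also have "\<dots> = bin_mean (Suc n) (\<lambda>j. (?\<Delta> j)\<^sup>2) - ?m\<^sup>2"
      by (subst bin_mean_add, subst bin_mean_diff, subst bin_mean_cmult)
        (simp add: power2_eq_square)
    finally show ?thesis by simp
  qed
  have "bin_var (Suc (Suc n)) g = (bin_var (Suc n) g + bin_var (Suc n) (\<lambda>j. g (Suc j))) / 2 +
      (bin_mean (Suc n) ?\<Delta>)\<^sup>2 / 4"
    unfolding bin_var_def bin_mean_diff
    by (subst (1 2) bin_mean_Suc) (simp add: power2_eq_square field_simps)
  also have "\<dots> \<le> (real (Suc n) / 4 * bin_mean n (\<lambda>j. (?\<Delta> j)\<^sup>2) +
      real (Suc n) / 4 * bin_mean n (\<lambda>j. (?\<Delta> (Suc j))\<^sup>2)) / 2 +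
      bin_mean (Suc n) (\<lambda>j. (?\<Delta> j)\<^sup>2) / 4"
    by (intro add_mono divide_right_mono Suc.IH jensen) simp_all
  also have "\<dots> = real (Suc (Suc n)) / 4 * bin_mean (Suc n) (\<lambda>j. (?\<Delta> j)\<^sup>2)"
    by (simp add: bin_mean_Suc field_simps)
  finally show ?case .
qed

text \<open>
  The function \<open>h j = f j + f (n - j)\<close> is even under exchange of the two sides, so its difference is
  odd and has mean zero.  Hence the second moment of the difference is again a variance and the Poincare
  inequality can be used twice: \<open>Var h\<close> is controlled by the second difference of \<open>f\<close>.  A single use
  would ignore the cancellation between the two sides.  The factor \<open>n (n - 1)\<close> so produced is turned into a
  pointwise weight by the size bias.
\<close>

lemma bin_var_symmetrised:
  "bin_var (Suc (Suc r)) (\<lambda>j. f j + f (Suc (Suc r) - j)) \<le>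
     bin_mean (Suc (Suc r))
       (\<lambda>j. real j * real (j - 1) * (f (j - 2 + 2) - 2 * f (j - 2 + 1) + f (j - 2))\<^sup>2)"
proof -
  let ?n = "Suc (Suc r)"
  define h where "h = (\<lambda>j. f j + f (?n - j))"
  define h1 where "h1 = (\<lambda>j. h (Suc j) - h j)"
  define D where "D = (\<lambda>j. f (j + 2) - 2 * f (j + 1) + f j)"
  \<comment> \<open>the difference of an even function is odd under reflection, hence has mean zero\<close>
  have h1_odd: "h1 (Suc r - j) = - h1 j" if "j \<le> Suc r" for j
    using that by (simp add: h1_def h_def Suc_diff_le)
  have "bin_mean (Suc r) h1 = bin_mean (Suc r) (\<lambda>j. h1 (Suc r - j))"
    by (rule bin_mean_reflect[symmetric])
  also have "\<dots> = bin_mean (Suc r) (\<lambda>j. (-1) * h1 j)"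
    by (rule bin_mean_cong) (simp add: h1_odd)
  finally have h1_mean: "bin_mean (Suc r) h1 = 0"
    by (subst (asm) bin_mean_cmult) simp
  have h1_diff: "h1 (Suc j) - h1 j = D j + D (r - j)" if "j \<le> r" for j
    using that by (simp add: h1_def h_def D_def Suc_diff_le algebra_simps)
  have "bin_var ?n h \<le> real ?n / 4 * bin_mean (Suc r) (\<lambda>j. (h1 j)\<^sup>2)"
    unfolding h1_def by (rule bin_var_poincare)
  also have "bin_mean (Suc r) (\<lambda>j. (h1 j)\<^sup>2) = bin_var (Suc r) h1"
    by (simp add: bin_var_def h1_mean)
  also have "\<dots> \<le> real (Suc r) / 4 * bin_mean r (\<lambda>j. (h1 (Suc j) - h1 j)\<^sup>2)"
    by (rule bin_var_poincare)
  also have "bin_mean r (\<lambda>j. (h1 (Suc j) - h1 j)\<^sup>2) \<le>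
      bin_mean r (\<lambda>j. 2 * (D j)\<^sup>2 + 2 * (D (r - j))\<^sup>2)"
  proof (rule bin_mean_mono)
    fix j assume "j \<le> r"
    have "0 \<le> (D j - D (r - j))\<^sup>2" by simp
    then show "(h1 (Suc j) - h1 j)\<^sup>2 \<le> 2 * (D j)\<^sup>2 + 2 * (D (r - j))\<^sup>2"
      unfolding h1_diff[OF \<open>j \<le> r\<close>] by (simp add: power2_eq_square algebra_simps)
  qed
  also have "\<dots> = 4 * bin_mean r (\<lambda>j. (D j)\<^sup>2)"
    using bin_mean_reflect[of r "\<lambda>j. (D j)\<^sup>2"] by (simp add: bin_mean_add bin_mean_cmult)
  also have "real ?n / 4 * (real (Suc r) / 4 * (4 * bin_mean r (\<lambda>j. (D j)\<^sup>2))) =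
      bin_mean ?n (\<lambda>j. real j * real (j - 1) * (D (j - 2))\<^sup>2)"
    using bin_mean_size_bias2[of r "\<lambda>j. (D j)\<^sup>2"] by simp
  finally show ?thesis
    by (simp add: h_def D_def mult_left_mono)
qed

section \<open>The probability that a fixed node is external\<close>

text \<open>
  The probability that a given node at level \<open>k\<close> of a tree of size \<open>n\<close> is external: along the path to it
  each node keeps one record and passes on a binomial number of the others, and the path must run out of
  records exactly at level \<open>k\<close>.
\<close>

fun path_prob :: "nat \<Rightarrow> nat \<Rightarrow> real" where
  "path_prob 0 0 = 1"
| "path_prob 0 (Suc k) = 0"
| "path_prob (Suc n) 0 = 0"
| "path_prob (Suc n) (Suc k) = bin_mean n (\<lambda>j. path_prob j k)"

lemma path_prob_nonneg: "0 \<le> path_prob n k"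
  by (induction n k rule: path_prob.induct) (auto intro: bin_mean_nonneg)

lemma path_prob_le_1: "path_prob n k \<le> 1"
proof (induction n k rule: path_prob.induct)
  case (4 n k)
  then show ?case using bin_mean_mono[of n "\<lambda>j. path_prob j k" "\<lambda>_. 1"] by simp
qed auto

lemma path_prob_eq_0: "n < k \<Longrightarrow> path_prob n k = 0"
proof (induction n k rule: path_prob.induct)
  case (4 n k)
  then have "path_prob (Suc n) (Suc k) = bin_mean n (\<lambda>_. 0)"
    unfolding path_prob.simps by (intro bin_mean_cong) auto
  then show ?case by simp
qed auto

text \<open>
  The probability at a level \<open>i\<close> higher up, extended by 0 above the root so that it obeys the same
  recursion as \<^const>\<open>path_prob\<close> at all levels.
\<close>

definition lagged_path_prob :: "nat \<Rightarrow> nat \<Rightarrow> nat \<Rightarrow> real" where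
  "lagged_path_prob i n k = (if i \<le> k then path_prob n (k - i) else 0)"

lemma lagged_path_prob_Suc:
  "lagged_path_prob i (Suc n) (Suc k) = bin_mean n (\<lambda>j. lagged_path_prob i j k)"
  by (cases "i \<le> k"; cases "i = Suc k") (auto simp: lagged_path_prob_def Suc_diff_le)

text \<open>
  One step down the path, a shift of the number of records survives only if the additional record follows
  the path.  The second difference therefore obeys the same recursion as \<^const>\<open>path_prob\<close>, with an
  additional factor \<open>1/4\<close> at each level.  It is thus a combination of \<^const>\<open>path_prob\<close> at levels \<open>k\<close>,
  \<open>k - 1\<close> and \<open>k - 2\<close>; the coefficients are read off at \<open>n = 0\<close>, where the second difference is
  \<open>1\<close>, \<open>-3/2\<close>, \<open>1/2\<close> for \<open>k = 0, 1, 2\<close> and \<open>0\<close> for larger \<open>k\<close>.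
\<close>

lemma path_prob_second_difference:
  "path_prob (n + 2) k - 2 * path_prob (n + 1) k + path_prob n k =
     (path_prob n k - 6 * lagged_path_prob 1 n k + 8 * lagged_path_prob 2 n k) / 4 ^ k"
proof (induction k arbitrary: n)
  case 0
  show ?case by (cases n) (auto simp: lagged_path_prob_def)
next
  case (Suc k)
  show ?case
  proof (cases n)
    case 0
    then show ?thesis
      by (cases k; cases "k - 1") (auto simp: lagged_path_prob_def bin_mean_Suc)
  next
    case (Suc m)
    have "path_prob (n + 2) (Suc k) - 2 * path_prob (n + 1) (Suc k) + path_prob n (Suc k) =
        bin_mean m (\<lambda>j. path_prob (j + 2) k - 2 * path_prob (j + 1) k + path_prob j k) / 4"
      using Suc by (simp add: bin_mean_Suc bin_mean_add bin_mean_diff bin_mean_cmult field_simps)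
    also have "\<dots> = bin_mean m (\<lambda>j. (1 / 4 ^ k) *
        (path_prob j k - 6 * lagged_path_prob 1 j k + 8 * lagged_path_prob 2 j k)) / 4"
      by (simp only: Suc.IH) simp
    also have "\<dots> = (path_prob n (Suc k) - 6 * lagged_path_prob 1 n (Suc k) +
        8 * lagged_path_prob 2 n (Suc k)) / 4 ^ Suc k"
      unfolding \<open>n = Suc m\<close> lagged_path_prob_Suc path_prob.simps bin_mean_cmult bin_mean_add bin_mean_diff
      by (simp add: field_simps)
    finally show ?thesis .
  qed
qed

text \<open>
  Comparison of neighbouring levels.  For \<open>n\<close> much smaller than \<open>2 ^ k\<close> the probability drops rapidly
  from one level to the next, but by no more than a factor of the order \<open>n / 2 ^ k\<close>, up to \<open>k + 1\<close>.
  In each step of the induction the size bias gives the factor \<open>n / 2\<close> instead of \<open>(n + 1) / 2\<close>; as a tree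
  of size less than \<open>k\<close> has no node at level \<open>k\<close>, these losses multiply to no more than the
  telescoping product \<open>k + 1\<close>.
\<close>

lemma path_prob_insert_level:
  "real (Suc n) * path_prob n k \<le> real (Suc k) * 2 ^ k * path_prob (Suc n) (Suc k)"
proof (induction k arbitrary: n)
  case 0
  have "0 \<le> bin_mean n (\<lambda>j. path_prob j 0)"
    by (intro bin_mean_nonneg path_prob_nonneg)
  then show ?case by (cases n) auto
next
  case (Suc k)
  show ?case
  proof (cases "n < Suc k")
    case True
    then show ?thesis
      using path_prob_nonneg[of "Suc n" "Suc (Suc k)"] path_prob_eq_0[of n "Suc k"] by simp
  next
    case False
    then obtain m where m: "n = Suc m" "k \<le> m"
      by (cases n) auto
    let ?q = "path_prob (Suc n) (Suc (Suc k))"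
    have "real (Suc m) / 2 * path_prob n (Suc k) =
        bin_mean (Suc m) (\<lambda>j. real j * path_prob (j - 1) k)"
      unfolding m path_prob.simps by (rule bin_mean_size_bias[symmetric])
    also have "\<dots> \<le> bin_mean (Suc m) (\<lambda>j. real (Suc k) * 2 ^ k * path_prob j (Suc k))"
    proof (rule bin_mean_mono)
      fix j
      show "real j * path_prob (j - 1) k \<le> real (Suc k) * 2 ^ k * path_prob j (Suc k)"
        using Suc.IH[of "j - 1"] by (cases j) auto
    qed
    also have "\<dots> = real (Suc k) * 2 ^ k * ?q"
      unfolding m path_prob.simps bin_mean_cmult ..
    finally have *: "real (Suc m) * path_prob n (Suc k) \<le> real (Suc k) * 2 ^ Suc k * ?q"
      by simp
    \<comment> \<open>the loss \<open>(n + 1) / n\<close> is at most \<open>(k + 2) / (k + 1)\<close> because \<open>k + 1 \<le> n\<close>\<close>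
    have "real (Suc n) * real (Suc k) \<le> real (Suc (Suc k)) * real (Suc m)"
      using m by (simp add: algebra_simps)
    then have "real (Suc n) * real (Suc k) * path_prob n (Suc k) \<le>
        real (Suc (Suc k)) * real (Suc m) * path_prob n (Suc k)"
      by (rule mult_right_mono) (rule path_prob_nonneg)
    also have "\<dots> = real (Suc (Suc k)) * (real (Suc m) * path_prob n (Suc k))"
      by simp
    also have "\<dots> \<le> real (Suc (Suc k)) * (real (Suc k) * 2 ^ Suc k * ?q)"
      by (rule mult_left_mono[OF *]) simp
    finally have "real (Suc k) * (real (Suc n) * path_prob n (Suc k)) \<le>
        real (Suc k) * (real (Suc (Suc k)) * 2 ^ Suc k * ?q)"
      by (simp only: mult_ac)
    then show ?thesis
      by (rule mult_left_le_imp_le) simp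
  qed
qed

text \<open>
  With probability one half an additional record leaves the path at the root and has no influence.
\<close>

lemma path_prob_Suc_ge: "0 < k \<Longrightarrow> path_prob n k \<le> 2 * path_prob (Suc n) k"
proof (cases n; cases k)
  fix m l assume "n = Suc m" "k = Suc l"
  moreover have "0 \<le> bin_mean m (\<lambda>j. path_prob (Suc j) l)"
    by (intro bin_mean_nonneg path_prob_nonneg)
  ultimately show ?thesis by (simp add: bin_mean_Suc)
qed (auto simp: path_prob_nonneg intro: bin_mean_nonneg)

text \<open>
  For \<open>n\<close> much larger than \<open>2 ^ k\<close> a node at level \<open>k\<close> is hardly ever empty; quadratic decay
  in \<open>n / 2 ^ k\<close>, up to a polynomial in \<open>k\<close>, is all that is needed.  The losses in the induction
  telescope as in the comparison of neighbouring levels.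
\<close>

lemma path_prob_decay:
  "real (n + 1) * real (n + 2) * path_prob n k \<le> real (k + 1) * real (k + 2) * 4 ^ k"
proof (induction k arbitrary: n)
  case 0
  show ?case by (cases n) auto
next
  case (Suc k)
  show ?case
  proof (cases "n < Suc k")
    case True
    then show ?thesis by (simp add: path_prob_eq_0)
  next
    case False
    then obtain m where m: "n = Suc m" "k \<le> m"
      by (cases n) auto
    let ?K = "real (k + 1) * real (k + 2) * 4 ^ k"
    have "real (Suc m) * real (Suc (Suc m)) / 4 * path_prob n (Suc k) =
        bin_mean (Suc (Suc m)) (\<lambda>j. real j * real (j - 1) * path_prob (j - 2) k)"
      unfolding m path_prob.simps by (rule bin_mean_size_bias2[symmetric])
    also have "\<dots> \<le> bin_mean (Suc (Suc m)) (\<lambda>j. ?K)"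
    proof (rule bin_mean_mono)
      fix j
      show "real j * real (j - 1) * path_prob (j - 2) k \<le> ?K"
      proof (cases "j < 2")
        case True
        then have "j = 0 \<or> j = 1" by auto
        then show ?thesis by auto
      next
        case False
        then obtain i where "j = i + 2" using le_Suc_ex[of 2 j] by auto
        then show ?thesis using Suc.IH[of i] by (simp add: mult_ac)
      qed
    qed
    finally have *: "real (m + 1) * real (m + 2) * path_prob n (Suc k) \<le> 4 * ?K"
      by simp
    have "real (m + 3) * real (k + 1) \<le> real (k + 3) * real (m + 1)"
      using m by (simp add: algebra_simps)
    then have "real (m + 3) * real (k + 1) * (real (m + 2) * path_prob n (Suc k)) \<le>
        real (k + 3) * real (m + 1) * (real (m + 2) * path_prob n (Suc k))"
      by (rule mult_right_mono) (simp add: path_prob_nonneg)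
    also have "\<dots> = real (k + 3) * (real (m + 1) * real (m + 2) * path_prob n (Suc k))"
      by simp
    also have "\<dots> \<le> real (k + 3) * (4 * ?K)"
      by (rule mult_left_mono[OF *]) simp
    finally have "real (k + 1) * (real (m + 2) * real (m + 3) * path_prob n (Suc k)) \<le>
        real (k + 1) * (real (k + 2) * real (k + 3) * 4 ^ Suc k)"
      by (simp add: mult_ac)
    then have "real (m + 2) * real (m + 3) * path_prob n (Suc k) \<le>
        real (k + 2) * real (k + 3) * 4 ^ Suc k"
      by (rule mult_left_le_imp_le) simp
    then show ?thesis using m by (simp add: numeral_eq_Suc)
  qed
qed

text \<open>
  The estimate that makes the variance linear in the mean: the weighted square of the second difference is
  at most \<open>4 ^ (-k)\<close> times a polynomial in \<open>k\<close> times the probability \<open>q\<close> itself.  By the formula for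
  the second difference this amounts to \<open>w x\<^sup>2 \<le> poly k * 4 ^ k * q\<close> with \<open>w = (n + 1) (n + 2)\<close> for \<open>x\<close>
  each of the probabilities \<open>a, b, c\<close> at the levels \<open>k\<close>, \<open>k - 1\<close>, \<open>k - 2\<close>.  Each of the two linear
  factors of \<open>w\<close> has to be paid by \<open>2 ^ k\<close>.  For \<open>a\<close> both are paid by the decay; for \<open>c\<close> both
  are paid by the two steps down to level \<open>k\<close>; for \<open>b\<close> one is paid in each way.
\<close>

lemma path_prob_curvature:
  assumes "0 < k"
  shows "real (n + 1) * real (n + 2) *
      (path_prob (n + 2) k - 2 * path_prob (n + 1) k + path_prob n k)\<^sup>2 \<le>
    312 * real (k + 2) ^ 2 / 4 ^ k * path_prob (n + 2) k"
proof -
  obtain l where l: "k = Suc l"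
    using assms by (cases k) auto
  define a b c q where "a = path_prob n k" and "b = lagged_path_prob 1 n k"
    and "c = lagged_path_prob 2 n k" and "q = path_prob (n + 2) k"
  define w where "w = real (n + 1) * real (n + 2)"
  define K where "K = (real (k + 2))\<^sup>2 * (4 ^ k * q)"
  have nonneg: "0 \<le> a" "0 \<le> b" "0 \<le> c" "0 \<le> q" "0 \<le> w"
    by (auto simp: a_def b_def c_def q_def w_def lagged_path_prob_def path_prob_nonneg)
  have le_1: "b \<le> 1" "c \<le> 1"
    by (auto simp: b_def c_def lagged_path_prob_def path_prob_le_1)
  have b: "b = path_prob n l"
    by (simp add: b_def l lagged_path_prob_def)
  have q1: "path_prob (n + 1) k \<le> 2 * q"
    using path_prob_Suc_ge[OF assms, of "n + 1"] by (simp add: q_def)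
  have "a \<le> 4 * q"
    using path_prob_Suc_ge[OF assms, of n] q1 by (simp add: a_def)
  have A: "w * a\<^sup>2 \<le> 4 * K"
  proof -
    have "w * a\<^sup>2 = (w * a) * a"
      by (simp add: power2_eq_square)
    also have "\<dots> \<le> (real (k + 1) * real (k + 2) * 4 ^ k) * (4 * q)"
      using path_prob_decay[of n k] nonneg
      by (intro mult_mono[OF _ \<open>a \<le> 4 * q\<close>]) (simp_all add: a_def w_def)
    also have "\<dots> = 4 * (real (k + 1) * real (k + 2)) * (4 ^ k * q)"
      by simp
    also have "\<dots> \<le> 4 * (real (k + 2))\<^sup>2 * (4 ^ k * q)"
      using nonneg by (intro mult_right_mono mult_left_mono) (auto simp: power2_eq_square)
    finally show ?thesis by (simp only: K_def mult.assoc)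
  qed
  have B: "w * b\<^sup>2 \<le> K"
  proof -
    have "real (n + 1) * b \<le> real k * 2 ^ l * path_prob (n + 1) k"
      using path_prob_insert_level[of n l] by (simp add: b l)
    also have "\<dots> \<le> real k * 2 ^ l * (2 * q)"
      using q1 by (intro mult_left_mono) auto
    finally have b1: "real (n + 1) * b \<le> real k * 2 ^ k * q"
      by (simp add: l)
    \<comment> \<open>the quadratic decay with \<open>b \<le> 1\<close> yields linear decay after taking the square root\<close>
    have "(real (n + 2) * b)\<^sup>2 = (real (n + 2))\<^sup>2 * (b * b)"
      by (simp add: power_mult_distrib power2_eq_square)
    also have "\<dots> \<le> (2 * w) * (b * 1)"
      using nonneg le_1
      by (intro mult_mono) (auto simp: w_def power2_eq_square algebra_simps)
    also have "\<dots> \<le> 2 * (real (l + 1) * real (l + 2) * 4 ^ l)"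
      using path_prob_decay[of n l] by (simp add: b w_def)
    also have "\<dots> \<le> 2 * (real (l + 1) * (2 * real (l + 1)) * 4 ^ l)"
      by (intro mult_left_mono mult_right_mono) auto
    also have "\<dots> = (real k * 2 ^ k)\<^sup>2"
      by (simp add: l power_mult_distrib power2_eq_square flip: power_mult_distrib)
    finally have b2: "real (n + 2) * b \<le> real k * 2 ^ k"
      by (rule power2_le_imp_le) simp
    have "w * b\<^sup>2 = (real (n + 2) * b) * (real (n + 1) * b)"
      by (simp add: w_def power2_eq_square)
    also have "\<dots> \<le> (real k * 2 ^ k) * (real k * 2 ^ k * q)"
      using nonneg by (intro mult_mono b1 b2) auto
    also have "\<dots> = (real k)\<^sup>2 * (4 ^ k * q)"
      by (simp add: power2_eq_square flip: power_mult_distrib)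
    also have "\<dots> \<le> (real (k + 2))\<^sup>2 * (4 ^ k * q)"
      using nonneg by (intro mult_right_mono power_mono) auto
    finally show ?thesis by (simp only: K_def)
  qed
  have C: "w * c\<^sup>2 \<le> K"
  proof (cases l)
    case 0
    then show ?thesis using nonneg by (simp add: K_def c_def l lagged_path_prob_def)
  next
    case (Suc i)
    have c: "c = path_prob n i"
      by (simp add: c_def l Suc lagged_path_prob_def)
    have "w * c\<^sup>2 = real (n + 2) * (real (n + 1) * c) * c"
      by (simp add: w_def power2_eq_square)
    also have "\<dots> \<le> real (n + 2) * (real (i + 1) * 2 ^ i * path_prob (n + 1) (i + 1)) * 1"
      using path_prob_insert_level[of n i] nonneg le_1 path_prob_nonneg[of "n + 1" "i + 1"]
      by (intro mult_mono[OF mult_left_mono]) (simp_all add: c)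
    also have "\<dots> = (real (i + 1) * 2 ^ i) * (real (n + 2) * path_prob (n + 1) (i + 1))"
      by simp
    also have "\<dots> \<le> (real (i + 1) * 2 ^ i) * (real (i + 2) * 2 ^ (i + 1) * q)"
      using path_prob_insert_level[of "n + 1" "i + 1"]
      by (intro mult_left_mono) (auto simp: q_def l Suc)
    also have "\<dots> \<le> (real (k + 2) * 2 ^ k) * (real (k + 2) * 2 ^ k * q)"
      using nonneg by (intro mult_mono power_increasing) (auto simp: l Suc)
    also have "\<dots> = (real (k + 2))\<^sup>2 * (4 ^ k * q)"
      by (simp add: power2_eq_square flip: power_mult_distrib)
    finally show ?thesis by (simp only: K_def)
  qed
  have "(a - 6 * b + 8 * c)\<^sup>2 \<le> 3 * (a\<^sup>2 + 36 * b\<^sup>2 + 64 * c\<^sup>2)"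
  proof -
    have "0 \<le> (a + 6 * b)\<^sup>2 + (a - 8 * c)\<^sup>2 + (6 * b + 8 * c)\<^sup>2" by simp
    then show ?thesis by (simp add: power2_eq_square algebra_simps)
  qed
  then have "w * (a - 6 * b + 8 * c)\<^sup>2 \<le> w * (3 * (a\<^sup>2 + 36 * b\<^sup>2 + 64 * c\<^sup>2))"
    using nonneg by (intro mult_left_mono)
  also have "\<dots> = 3 * (w * a\<^sup>2 + 36 * (w * b\<^sup>2) + 64 * (w * c\<^sup>2))"
    by (simp add: algebra_simps)
  also have "\<dots> \<le> 312 * K"
    using A B C by (simp add: distrib_left)
  finally have main: "w * (a - 6 * b + 8 * c)\<^sup>2 \<le> 312 * K" .
  have "w * ((a - 6 * b + 8 * c) / 4 ^ k)\<^sup>2 = w * (a - 6 * b + 8 * c)\<^sup>2 / (4 ^ k)\<^sup>2"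
    by (simp add: power_divide)
  also have "\<dots> \<le> 312 * K / (4 ^ k)\<^sup>2"
    using main by (rule divide_right_mono) simp
  also have "\<dots> = 312 * real (k + 2) ^ 2 / 4 ^ k * q"
    by (simp add: K_def power2_eq_square)
  finally show ?thesis
    unfolding path_prob_second_difference w_def a_def b_def c_def q_def .
qed

text \<open>
  The variance that arises from the random splitting at the root.  Relative to the mean profile
  \<open>2 ^ (k + 1) * path_prob (n + 1) (k + 1)\<close> it is at most of the order \<open>k\<^sup>2 / 2 ^ k\<close>.
\<close>

lemma bin_var_path_prob:
  "4 ^ k * bin_var n (\<lambda>j. path_prob j k + path_prob (n - j) k) \<le>
     312 * real (k + 2) ^ 2 * path_prob (Suc n) (Suc k)"
proof (cases "k = 0")
  case True
  \<comment> \<open>at level 0 the summands are indicators of empty subtrees, and the second moment is enough\<close>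
  have "bin_var n (\<lambda>j. path_prob j 0 + path_prob (n - j) 0) \<le>
      bin_mean n (\<lambda>j. (path_prob j 0 + path_prob (n - j) 0)\<^sup>2)"
    by (simp add: bin_var_def)
  also have "\<dots> \<le> bin_mean n (\<lambda>j. 2 * path_prob j 0 + 2 * path_prob (n - j) 0)"
  proof (rule bin_mean_mono)
    fix j
    let ?s = "path_prob j 0 + path_prob (n - j) 0"
    have "?s * ?s \<le> 2 * ?s"
      using path_prob_nonneg[of j 0] path_prob_nonneg[of "n - j" 0]
        path_prob_le_1[of j 0] path_prob_le_1[of "n - j" 0]
      by (intro mult_right_mono) auto
    then show "?s\<^sup>2 \<le> 2 * path_prob j 0 + 2 * path_prob (n - j) 0"
      by (simp add: power2_eq_square)
  qed
  also have "\<dots> = 4 * path_prob (Suc n) 1"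
    using bin_mean_reflect[of n "\<lambda>j. path_prob j 0"] by (simp add: bin_mean_add bin_mean_cmult)
  finally show ?thesis
    using True path_prob_nonneg[of "Suc n" 1] by simp
next
  case k: False
  let ?Q = "312 * real (k + 2) ^ 2 / 4 ^ k"
  have "bin_var n (\<lambda>j. path_prob j k + path_prob (n - j) k) \<le> ?Q * path_prob (Suc n) (Suc k)"
  proof (cases "n < 2")
    case True
    then have "n = 0 \<or> n = 1" by auto
    \<comment> \<open>the even function is constant on at most two points that are exchanged by reflection\<close>
    then have "bin_var n (\<lambda>j. path_prob j k + path_prob (n - j) k) = 0"
      by (auto simp: bin_var_def bin_mean_Suc power2_eq_square field_simps)
    then show ?thesis
      using path_prob_nonneg[of "Suc n" "Suc k"] by simp
  next
    case False
    then obtain r where r: "n = Suc (Suc r)"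
      by (cases n; cases "n - 1") auto
    have "bin_var n (\<lambda>j. path_prob j k + path_prob (n - j) k) \<le>
        bin_mean n (\<lambda>j. real j * real (j - 1) *
          (path_prob (j - 2 + 2) k - 2 * path_prob (j - 2 + 1) k + path_prob (j - 2) k)\<^sup>2)"
      unfolding r by (rule bin_var_symmetrised)
    also have "\<dots> \<le> bin_mean n (\<lambda>j. ?Q * path_prob j k)"
    proof (rule bin_mean_mono)
      fix j
      show "real j * real (j - 1) *
          (path_prob (j - 2 + 2) k - 2 * path_prob (j - 2 + 1) k + path_prob (j - 2) k)\<^sup>2 \<le>
        ?Q * path_prob j k"
      proof (cases "j < 2")
        case True
        then have "j = 0 \<or> j = 1" by auto
        moreover have "0 \<le> ?Q * path_prob j k"
          using path_prob_nonneg[of j k] by simp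
        ultimately show ?thesis by auto
      next
        case False
        then obtain i where i: "j = i + 2" using le_Suc_ex[of 2 j] by auto
        show ?thesis
          using path_prob_curvature[of k i] k unfolding i by (simp add: mult_ac)
      qed
    qed
    also have "\<dots> = ?Q * path_prob (Suc n) (Suc k)"
      by (simp only: bin_mean_cmult path_prob.simps)
    finally show ?thesis .
  qed
  then have "4 ^ k * bin_var n (\<lambda>j. path_prob j k + path_prob (n - j) k) \<le>
      4 ^ k * (?Q * path_prob (Suc n) (Suc k))"
    by (rule mult_left_mono) simp
  then show ?thesis by simp
qed

section \<open>The law of the external profile and its variance\<close>

text \<open>
  The law of the external profile in its recursive description, \<open>j\<close> records going to the right subtree.
\<close>

fun profile_law :: "nat \<Rightarrow> nat \<Rightarrow> nat pmf" where
  "profile_law 0 0 = return_pmf 1"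
| "profile_law 0 (Suc k) = return_pmf 0"
| "profile_law (Suc n) 0 = return_pmf 0"
| "profile_law (Suc n) (Suc k) =
     binomial_pmf n (1/2) \<bind>
       (\<lambda>j. map_pmf (\<lambda>(x, y). x + y) (pair_pmf (profile_law (n - j) k) (profile_law j k)))"

lemma finite_set_profile_law [simp]: "finite (set_pmf (profile_law n k))"
  by (induction n k rule: profile_law.induct) auto

lemma integrable_profile_law [simp]:
  "integrable (measure_pmf (profile_law n k)) (f :: nat \<Rightarrow> real)"
  by (simp add: integrable_measure_pmf_finite)

lemma expectation_pair_pmf:
  fixes h :: "'a \<times> 'b \<Rightarrow> real"
  assumes "finite (set_pmf p)" "finite (set_pmf q)"
  shows "measure_pmf.expectation (pair_pmf p q) h =
    measure_pmf.expectation p (\<lambda>x. measure_pmf.expectation q (\<lambda>y. h (x, y)))"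
proof -
  have "pair_pmf p q = p \<bind> (\<lambda>x. map_pmf (Pair x) q)"
    by (simp add: pair_pmf_def map_pmf_def)
  then show ?thesis
    using assms
    by (simp add: pmf_expectation_bind[of "set_pmf p"] integral_measure_pmf[of "set_pmf p" p])
qed

lemma expectation_profile_law_Suc:
  "measure_pmf.expectation (profile_law (Suc n) (Suc k)) h =
     bin_mean n (\<lambda>j. measure_pmf.expectation (profile_law (n - j) k) (\<lambda>x.
       measure_pmf.expectation (profile_law j k) (\<lambda>y. h (x + y))))"
  unfolding profile_law.simps bin_mean_sum
  by (subst pmf_expectation_bind[of "{..n}"]) (auto simp: expectation_pair_pmf)

lemma expectation_profile_law:
  "measure_pmf.expectation (profile_law n k) real = 2 ^ k * path_prob n k"
proof (induction n k rule: path_prob.induct)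
  case (4 n k)
  have "measure_pmf.expectation (profile_law (Suc n) (Suc k)) real =
      bin_mean n (\<lambda>j. 2 ^ k * path_prob (n - j) k + 2 ^ k * path_prob j k)"
    unfolding expectation_profile_law_Suc by (rule bin_mean_cong) (simp add: 4)
  also have "\<dots> = 2 ^ Suc k * path_prob (Suc n) (Suc k)"
    using bin_mean_reflect[of n "\<lambda>j. path_prob j k"] by (simp add: bin_mean_add bin_mean_cmult)
  finally show ?case .
qed auto

text \<open>
  The law of total variance, conditioning on the sizes of the two subtrees.
\<close>

lemma variance_profile_law_Suc:
  "measure_pmf.variance (profile_law (Suc n) (Suc k)) real =
     2 * bin_mean n (\<lambda>j. measure_pmf.variance (profile_law j k) real) +
     4 ^ k * bin_var n (\<lambda>j. path_prob j k + path_prob (n - j) k)"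
proof -
  define s where "s = (\<lambda>j. path_prob j k + path_prob (n - j) k)"
  define v where "v = (\<lambda>j. measure_pmf.variance (profile_law j k) real)"
  have second_moment: "measure_pmf.expectation (profile_law j k) (\<lambda>x. (real x)\<^sup>2) =
      v j + (2 ^ k * path_prob j k)\<^sup>2" for j
    unfolding v_def by (subst measure_pmf.variance_eq) (auto simp: expectation_profile_law)
  have "measure_pmf.expectation (profile_law (n - j) k) (\<lambda>x.
      measure_pmf.expectation (profile_law j k) (\<lambda>y. (real (x + y))\<^sup>2)) =
    v j + v (n - j) + 4 ^ k * (s j)\<^sup>2" for j
  proof -
    have "measure_pmf.expectation (profile_law (n - j) k) (\<lambda>x.
        measure_pmf.expectation (profile_law j k) (\<lambda>y. (real (x + y))\<^sup>2)) =
      v j + v (n - j) + (2 ^ k * s j)\<^sup>2"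
      by (simp add: power2_sum second_moment expectation_profile_law s_def distrib_left)
    then show ?thesis
      by (simp add: power2_eq_square flip: power_mult_distrib)
  qed
  then have "measure_pmf.expectation (profile_law (Suc n) (Suc k)) (\<lambda>x. (real x)\<^sup>2) =
      bin_mean n (\<lambda>j. v j + v (n - j) + 4 ^ k * (s j)\<^sup>2)"
    unfolding expectation_profile_law_Suc by simp
  also have "\<dots> = 2 * bin_mean n v + 4 ^ k * bin_mean n (\<lambda>j. (s j)\<^sup>2)"
    using bin_mean_reflect[of n v] by (simp add: bin_mean_add bin_mean_cmult)
  finally have *: "measure_pmf.variance (profile_law (Suc n) (Suc k)) real =
      2 * bin_mean n v + 4 ^ k * bin_mean n (\<lambda>j. (s j)\<^sup>2) -
      (measure_pmf.expectation (profile_law (Suc n) (Suc k)) real)\<^sup>2"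
    by (subst measure_pmf.variance_eq) (simp_all del: profile_law.simps)
  have "measure_pmf.expectation (profile_law (Suc n) (Suc k)) real = 2 ^ k * bin_mean n s"
    unfolding expectation_profile_law s_def
    using bin_mean_reflect[of n "\<lambda>j. path_prob j k"] by (simp add: bin_mean_add)
  then have "(measure_pmf.expectation (profile_law (Suc n) (Suc k)) real)\<^sup>2 =
      4 ^ k * (bin_mean n s)\<^sup>2"
    by (simp only: power_mult_distrib) (simp add: power2_eq_square flip: power_mult_distrib)
  with * show ?thesis
    unfolding bin_var_def v_def s_def by (simp only: right_diff_distrib)
qed

text \<open>
  Unrolling the recursion gives the constant \<open>312 (\<Sum>i<k. (i + 2)\<^sup>2 / 2 ^ (i + 1))\<close> in front of the mean:
  at each level the mean is preserved and the splitting adds its own contribution.  The bound states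
  the closed form of this sum, which has the limit \<open>312 * 11 = 3432\<close>.
\<close>

lemma variance_profile_law_le:
  "measure_pmf.variance (profile_law n k) real \<le>
     312 * (11 - (real k ^ 2 + 6 * real k + 11) / 2 ^ k) *
     measure_pmf.expectation (profile_law n k) real"
proof (induction n k rule: path_prob.induct)
  case (4 n k)
  let ?C = "\<lambda>k. 312 * (11 - (real k ^ 2 + 6 * real k + 11) / 2 ^ k)"
  let ?p = "path_prob (Suc n) (Suc k)"
  have "bin_mean n (\<lambda>j. measure_pmf.variance (profile_law j k) real) \<le>
      bin_mean n (\<lambda>j. ?C k * 2 ^ k * path_prob j k)"
    using 4 unfolding expectation_profile_law by (intro bin_mean_mono) (simp only: mult.assoc)
  also have "\<dots> = ?C k * 2 ^ k * ?p"
    by (simp only: bin_mean_cmult path_prob.simps)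
  finally have "measure_pmf.variance (profile_law (Suc n) (Suc k)) real \<le>
      2 * (?C k * 2 ^ k * ?p) + 312 * real (k + 2) ^ 2 * ?p"
    unfolding variance_profile_law_Suc using bin_var_path_prob[of k n] by linarith
  also have "\<dots> = ?C (Suc k) * (2 ^ Suc k * ?p)"
    by (simp add: field_simps power2_eq_square)
  finally show ?case
    by (simp only: expectation_profile_law)
qed auto

corollary variance_profile_law_linear:
  "measure_pmf.variance (profile_law n k) real \<le>
     3432 * measure_pmf.expectation (profile_law n k) real"
proof -
  have "312 * (11 - (real k ^ 2 + 6 * real k + 11) / 2 ^ k) \<le> 3432"
    by simp
  then have "312 * (11 - (real k ^ 2 + 6 * real k + 11) / 2 ^ k) *
      measure_pmf.expectation (profile_law n k) real \<le>
      3432 * measure_pmf.expectation (profile_law n k) real"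
    by (rule mult_right_mono) simp
  with variance_profile_law_le[of n k] show ?thesis by linarith
qed

section \<open>From independent bits to the recursive law\<close>

text \<open>
  Level \<open>k\<close> of the tree depends on \<open>k\<close> bits of each record only.  This reduces the infinite records to
  finitely many coins, and it shows that the two subtrees use disjoint sets of bits.
\<close>

lemma external_nodes_at_cong:
  assumes "\<And>i j. i \<in> set is \<Longrightarrow> d \<le> j \<Longrightarrow> j < d + k \<Longrightarrow> \<beta> i j = \<beta>' i j"
  shows "external_nodes_at (dst_from d (map \<beta> is)) k = external_nodes_at (dst_from d (map \<beta>' is)) k"
  using assms
proof (induction k arbitrary: d "is")
  case 0
  show ?case by (cases "is") auto
next
  case (Suc k)
  show ?case
  proof (cases "is")
    case (Cons i0 is')
    have "filter (\<lambda>i. \<beta> i d) is' = filter (\<lambda>i. \<beta>' i d) is'"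
      "filter (\<lambda>i. \<not> \<beta> i d) is' = filter (\<lambda>i. \<not> \<beta>' i d) is'"
      using Suc.prems by (auto simp: Cons intro!: filter_cong)
    then show ?thesis
      using Suc.prems unfolding Cons
      by (auto simp: filter_map o_def intro!: Suc.IH arg_cong2[where f = "(+)"])
  qed simp
qed

abbreviation coins :: "'i set \<Rightarrow> ('i \<Rightarrow> bool) pmf" where
  "coins A \<equiv> Pi_pmf A False (\<lambda>_. bernoulli_pmf (1/2))"

lemma map_coins_independent:
  assumes "finite A" "B \<subseteq> A"
    and X: "\<And>f g. (\<And>x. x \<in> B \<Longrightarrow> f x = g x) \<Longrightarrow> X f = X g"
    and Y: "\<And>f g. (\<And>x. x \<in> A - B \<Longrightarrow> f x = g x) \<Longrightarrow> Y f = Y g"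
  shows "map_pmf (\<lambda>f. (X f, Y f)) (coins A) =
    pair_pmf (map_pmf X (coins B)) (map_pmf Y (coins (A - B)))"
proof -
  have "coins A = coins (B \<union> (A - B))"
    using assms by (simp add: Un_absorb1)
  also have "\<dots> = map_pmf (\<lambda>(f, g) x. if x \<in> B then f x else g x) (pair_pmf (coins B) (coins (A - B)))"
    using assms finite_subset by (intro Pi_pmf_union) auto
  finally have "map_pmf (\<lambda>f. (X f, Y f)) (coins A) =
      map_pmf (\<lambda>(f, g). (X f, Y g)) (pair_pmf (coins B) (coins (A - B)))"
    by (auto simp: pmf.map_comp intro!: map_pmf_cong X Y)
  then show ?thesis
    by (simp add: map_pair)
qed

text \<open>
  Reveal the bits at position \<open>d\<close> of all records but the first: they fix how the records split, and the bits
  below, which decide on the two subtrees, are independent of them and of each other.  The set \<open>A\<close>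
  may contain more bits than needed, so that the induction hypothesis applies to whatever is left
  once the revealed bits are removed.
\<close>

lemma profile_law_of_bits:
  fixes "is" :: "'i list"
  assumes "distinct is" "finite A" "set is \<times> {d..<d + k} \<subseteq> A"
  shows "map_pmf (\<lambda>f. external_nodes_at (dst_from d (map (curry f) is)) k) (coins A) =
    profile_law (length is) k"
  using assms
proof (induction k arbitrary: d "is" A)
  case 0
  show ?case by (cases "is") auto
next
  case (Suc k)
  show ?case
  proof (cases "is")
    case Nil
    then show ?thesis by simp
  next
    case (Cons i0 is')
    define C where "C = set is' \<times> {d}"
    define ext where "ext = (\<lambda>js (f :: 'i \<times> nat \<Rightarrow> bool). external_nodes_at (dst_from (Suc d) (map (curry f) js)) k)"
    define children where
      "children = (\<lambda>j. map_pmf (\<lambda>(x, y). x + y) (pair_pmf (profile_law (length is' - j) k) (profile_law j k)))"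
    have ext_cong: "ext js f = ext js g"
      if "\<And>x. x \<in> set js \<times> {Suc d..<Suc d + k} \<Longrightarrow> f x = g x" for js and f g :: "'i \<times> nat \<Rightarrow> bool"
      unfolding ext_def by (rule external_nodes_at_cong) (auto intro!: that)
    have "distinct is'" "finite A" "C \<subseteq> A" and rest: "set is' \<times> {Suc d..<Suc d + k} \<subseteq> A - C"
      using Suc.prems by (auto simp: Cons C_def)
    have "finite C"
      by (simp add: C_def)
    have *: "map_pmf (\<lambda>g. ext (filter (\<lambda>i. \<not> f (i, d)) is') g + ext (filter (\<lambda>i. f (i, d)) is') g)
        (coins (A - C)) = children (card {x \<in> C. f x})" for f
    proof -
      let ?L = "filter (\<lambda>i. \<not> f (i, d)) is'" and ?R = "filter (\<lambda>i. f (i, d)) is'"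
      let ?B = "set ?L \<times> {Suc d..<Suc d + k}"
      have "bij_betw (\<lambda>i. (i, d)) (set ?R) {x \<in> C. f x}"
        by (auto simp: bij_betw_def inj_on_def C_def)
      then have len_R: "length ?R = card {x \<in> C. f x}"
        using \<open>distinct is'\<close> by (metis bij_betw_same_card distinct_card distinct_filter)
      have len_L: "length ?L = length is' - length ?R"
        using sum_length_filter_compl[of "\<lambda>i. f (i, d)" is'] by simp
      have "map_pmf (\<lambda>g. (ext ?L g, ext ?R g)) (coins (A - C)) =
          pair_pmf (map_pmf (ext ?L) (coins ?B)) (map_pmf (ext ?R) (coins (A - C - ?B)))"
        using rest \<open>finite A\<close> by (intro map_coins_independent ext_cong) auto
      also have "map_pmf (ext ?L) (coins ?B) = profile_law (length ?L) k"
        unfolding ext_def using \<open>distinct is'\<close> by (intro Suc.IH) auto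
      also have "map_pmf (ext ?R) (coins (A - C - ?B)) = profile_law (length ?R) k"
        unfolding ext_def using \<open>distinct is'\<close> \<open>finite A\<close> rest by (intro Suc.IH) auto
      finally have "map_pmf (\<lambda>(x, y). x + y) (map_pmf (\<lambda>g. (ext ?L g, ext ?R g)) (coins (A - C))) =
          children (length ?R)"
        by (simp add: children_def len_L)
      then show ?thesis
        by (simp add: pmf.map_comp o_def len_R)
    qed
    have "coins A = coins (C \<union> (A - C))"
      using \<open>C \<subseteq> A\<close> by (simp add: Un_absorb1)
    also have "\<dots> = coins C \<bind> (\<lambda>f. map_pmf (\<lambda>g x. if x \<in> C then f x else g x) (coins (A - C)))"
      using \<open>finite A\<close> \<open>finite C\<close>
      by (subst Pi_pmf_union) (auto simp: pair_pmf_def map_pmf_def bind_assoc_pmf bind_return_pmf)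
    finally have "map_pmf (\<lambda>f. external_nodes_at (dst_from d (map (curry f) is)) (Suc k)) (coins A) =
        coins C \<bind> (\<lambda>f. map_pmf (\<lambda>g. external_nodes_at (dst_from d
          (map (curry (\<lambda>x. if x \<in> C then f x else g x)) is)) (Suc k)) (coins (A - C)))"
      by (simp add: map_bind_pmf pmf.map_comp o_def)
    also have "\<dots> = coins C \<bind> (\<lambda>f. children (card {x \<in> C. f x}))"
    proof -
      have "external_nodes_at (dst_from d
          (map (curry (\<lambda>x. if x \<in> C then f x else g x)) is)) (Suc k) =
          ext (filter (\<lambda>i. \<not> f (i, d)) is') g + ext (filter (\<lambda>i. f (i, d)) is') g" for f g
      proof -
        let ?h = "\<lambda>x. if x \<in> C then f x else g x"
        have "filter (\<lambda>i. ?h (i, d)) is' = filter (\<lambda>i. f (i, d)) is'"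
          "filter (\<lambda>i. \<not> ?h (i, d)) is' = filter (\<lambda>i. \<not> f (i, d)) is'"
          by (auto simp: C_def intro!: filter_cong)
        then have "external_nodes_at (dst_from d (map (curry ?h) is)) (Suc k) =
            ext (filter (\<lambda>i. \<not> f (i, d)) is') ?h + ext (filter (\<lambda>i. f (i, d)) is') ?h"
          by (simp add: Cons ext_def filter_map o_def curry_def)
        also have "ext (filter (\<lambda>i. \<not> f (i, d)) is') ?h = ext (filter (\<lambda>i. \<not> f (i, d)) is') g"
          by (rule ext_cong) (auto simp: C_def)
        also have "ext (filter (\<lambda>i. f (i, d)) is') ?h = ext (filter (\<lambda>i. f (i, d)) is') g"
          by (rule ext_cong) (auto simp: C_def)
        finally show ?thesis .
      qed
      then show ?thesis by (simp add: *)
    qed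
    also have "\<dots> = map_pmf (\<lambda>f. card {x \<in> C. f x}) (coins C) \<bind> children"
      by (simp add: bind_map_pmf)
    also have "map_pmf (\<lambda>f. card {x \<in> C. f x}) (coins C) = binomial_pmf (length is') (1/2)"
      using \<open>distinct is'\<close>
      by (intro binomial_pmf_altdef'[symmetric] \<open>finite C\<close>)
        (auto simp: C_def card_cartesian_product distinct_card)
    finally show ?thesis
      by (simp add: Cons children_def)
  qed
qed

text \<open>
  The joint law of finitely many independent fair bits on an arbitrary probability space is the product
  of coins.  All values lie in a finite set, so comparing the atoms suffices although the type of all bit
  assignments may be uncountable.
\<close>

lemma (in prob_space) distr_bits_eq_coins:
  fixes X :: "'i \<Rightarrow> 'a \<Rightarrow> bool"
  assumes indep: "indep_vars (\<lambda>_. count_space UNIV) X A" and "finite A"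
    and fair: "\<And>x. x \<in> A \<Longrightarrow> distr M (count_space UNIV) (X x) = measure_pmf (bernoulli_pmf (1/2))"
  defines "Y \<equiv> \<lambda>\<omega> x. if x \<in> A then X x \<omega> else False"
  shows "Y \<in> measurable M (count_space UNIV)"
    and "distr M (count_space UNIV) Y = measure_pmf (coins A)"
proof -
  let ?S = "PiE_dflt A False (\<lambda>_. UNIV :: bool set)"
  have fin_S: "finite ?S"
    using \<open>finite A\<close> by (intro finite_PiE_dflt) auto
  have Y_in: "Y \<omega> \<in> ?S" for \<omega>
    by (auto simp: Y_def PiE_dflt_def)
  have meas_X: "X x \<in> measurable M (count_space UNIV)" if "x \<in> A" for x
    using indep that by (auto simp: indep_vars_def)
  have atom: "Y -` {f} \<inter> space M \<in> sets M \<and> prob (Y -` {f} \<inter> space M) = (1/2) ^ card A"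
    if f: "f \<in> ?S" for f
  proof (cases "A = {}")
    case True
    then have "Y -` {f} \<inter> space M = space M"
      using f by (auto simp: Y_def PiE_dflt_def fun_eq_iff)
    then show ?thesis
      using True by (simp add: prob_space)
  next
    case False
    have eq: "Y -` {f} \<inter> space M = (\<Inter>x\<in>A. X x -` {f x} \<inter> space M)"
      using f False by (auto simp: Y_def PiE_dflt_def fun_eq_iff)
    have "prob (\<Inter>x\<in>A. X x -` {f x} \<inter> space M) = (\<Prod>x\<in>A. prob (X x -` {f x} \<inter> space M))"
      by (rule indep_varsD_finite[OF indep False \<open>finite A\<close>]) simp
    also have "\<dots> = (\<Prod>x\<in>A. 1/2)"
    proof (rule prod.cong)
      fix x assume x: "x \<in> A"
      have "prob (X x -` {f x} \<inter> space M) = measure (distr M (count_space UNIV) (X x)) {f x}"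
        by (simp add: measure_distr meas_X x)
      also have "\<dots> = 1/2"
        by (cases "f x") (simp_all add: fair[OF x] measure_pmf_single)
      finally show "prob (X x -` {f x} \<inter> space M) = 1/2" .
    qed simp
    finally have "prob (\<Inter>x\<in>A. X x -` {f x} \<inter> space M) = (1/2) ^ card A"
      by simp
    moreover have "(\<Inter>x\<in>A. X x -` {f x} \<inter> space M) \<in> sets M"
      using False \<open>finite A\<close> meas_X by (intro sets.finite_INT) (auto intro: measurable_sets)
    ultimately show ?thesis
      unfolding eq by simp
  qed
  show Y_meas: "Y \<in> measurable M (count_space UNIV)"
  proof (rule measurableI)
    fix Q :: "('i \<Rightarrow> bool) set"
    have "Y -` Q \<inter> space M = (\<Union>f\<in>?S \<inter> Q. Y -` {f} \<inter> space M)"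
      using Y_in by auto
    also have "\<dots> \<in> sets M"
      using fin_S atom by (intro sets.finite_UN) auto
    finally show "Y -` Q \<inter> space M \<in> sets M" .
  qed simp
  show "distr M (count_space UNIV) Y = measure_pmf (coins A)"
  proof (rule measure_eqI_countable_AE[where \<Omega> = ?S])
    show "AE f in distr M (count_space UNIV) Y. f \<in> ?S"
      using Y_in by (simp add: AE_distr_iff Y_meas)
    show "AE f in measure_pmf (coins A). f \<in> ?S"
      using \<open>finite A\<close> by (auto simp: AE_measure_pmf_iff set_Pi_pmf PiE_dflt_def)
    show "countable ?S"
      using fin_S by (rule countable_finite)
    fix f assume f: "f \<in> ?S"
    have "emeasure (distr M (count_space UNIV) Y) {f} = ennreal ((1/2) ^ card A)"
      using atom[OF f] by (simp add: emeasure_distr Y_meas emeasure_eq_measure)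
    also have "(1/2) ^ card A = pmf (coins A) f"
    proof -
      have half: "pmf (bernoulli_pmf (1/2)) c = 1/2" for c
        by (cases c) simp_all
      show ?thesis
        using f by (subst pmf_Pi'[OF \<open>finite A\<close>]) (auto simp: PiE_dflt_def half)
    qed
    finally show "emeasure (distr M (count_space UNIV) Y) {f} = emeasure (measure_pmf (coins A)) {f}"
      by (simp add: emeasure_pmf_single)
  qed simp_all
qed

section \<open>Concentration of the external profile\<close>

lemma external_profile_distr:
  assumes "prob_space M" "symmetric_bits M n b"
  shows "external_profile b n k \<in> borel_measurable M"
    and "distr M borel (external_profile b n k) = distr (measure_pmf (profile_law n k)) borel real"
proof -
  interpret prob_space M by fact
  define A where "A = {..<n} \<times> {..<k}"
  define X where "X = (\<lambda>(i, j). b i j)"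
  define Y where "Y = (\<lambda>\<omega> x. if x \<in> A then X x \<omega> else False)"
  define \<Phi> where "\<Phi> = (\<lambda>f. external_nodes_at (dst_from 0 (map (curry f) [0..<n])) k)"
  have indep: "indep_vars (\<lambda>_. count_space UNIV) X A"
    using assms(2) unfolding symmetric_bits_def X_def
    by (elim conjE indep_vars_subset) (auto simp: A_def)
  have fair: "distr M (count_space UNIV) (X x) = measure_pmf (bernoulli_pmf (1/2))" if "x \<in> A" for x
    using assms(2) that unfolding symmetric_bits_def
    by (auto simp: X_def A_def bernoulli_pmf_half_conv_pmf_of_set)
  have "finite A"
    by (simp add: A_def)
  then have Y: "Y \<in> measurable M (count_space UNIV)"
    unfolding Y_def by (rule distr_bits_eq_coins(1)[OF indep _ fair])
  have Y_law: "distr M (count_space UNIV) Y = measure_pmf (coins A)"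
    unfolding Y_def by (rule distr_bits_eq_coins(2)[OF indep \<open>finite A\<close> fair])
  have profile: "external_profile b n k = (\<lambda>\<omega>. real (\<Phi> (Y \<omega>)))"
  proof
    fix \<omega>
    have "external_nodes_at (dst_from 0 (map (\<lambda>i j. b i j \<omega>) [0..<n])) k = \<Phi> (Y \<omega>)"
      unfolding \<Phi>_def by (rule external_nodes_at_cong) (auto simp: Y_def X_def A_def curry_def)
    then show "external_profile b n k \<omega> = real (\<Phi> (Y \<omega>))"
      by (simp add: external_profile_def dst_def)
  qed
  show "external_profile b n k \<in> borel_measurable M"
    unfolding profile by (rule measurable_compose[OF Y]) simp_all
  have "distr M borel (external_profile b n k) =
      distr (distr M (count_space UNIV) Y) borel (\<lambda>f. real (\<Phi> f))"
    unfolding profile by (subst distr_distr) (simp_all add: Y o_def)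
  also have "\<dots> = distr (measure_pmf (map_pmf \<Phi> (coins A))) borel real"
    unfolding Y_law map_pmf_rep_eq by (subst distr_distr) (simp_all add: o_def)
  also have "map_pmf \<Phi> (coins A) = profile_law n k"
    unfolding \<Phi>_def using profile_law_of_bits[of "[0..<n]" A 0 k]
    by (simp add: A_def lessThan_atLeast0)
  finally show "distr M borel (external_profile b n k) =
      distr (measure_pmf (profile_law n k)) borel real" .
qed

lemma external_profile_moments:
  fixes h :: "real \<Rightarrow> real"
  assumes "prob_space M" "symmetric_bits M n b" and h: "h \<in> borel_measurable borel"
  shows "integrable M (\<lambda>\<omega>. h (external_profile b n k \<omega>))"
    and "(\<integral>\<omega>. h (external_profile b n k \<omega>) \<partial>M) =
      measure_pmf.expectation (profile_law n k) (\<lambda>x. h (real x))"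
proof -
  note law = external_profile_distr[OF assms(1,2), of k]
  have "integrable (distr M borel (external_profile b n k)) h"
    unfolding law(2) using h by (subst integrable_distr_eq) auto
  then show "integrable M (\<lambda>\<omega>. h (external_profile b n k \<omega>))"
    using law(1) h by (subst (asm) integrable_distr_eq) auto
  have "(\<integral>\<omega>. h (external_profile b n k \<omega>) \<partial>M) = (\<integral>x. h x \<partial>distr M borel (external_profile b n k))"
    using law(1) h by (subst integral_distr) auto
  also have "\<dots> = measure_pmf.expectation (profile_law n k) (\<lambda>x. h (real x))"
    unfolding law(2) using h by (subst integral_distr) auto
  finally show "(\<integral>\<omega>. h (external_profile b n k \<omega>) \<partial>M) =
      measure_pmf.expectation (profile_law n k) (\<lambda>x. h (real x))" .
qed

theorem variance_external_profile_le:
  assumes "prob_space M" "symmetric_bits M n b"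
  shows "prob_space.variance M (external_profile b n k) \<le>
    3432 * prob_space.expectation M (external_profile b n k)"
  using variance_profile_law_linear[of n k]
    external_profile_moments(2)[OF assms, of "\<lambda>x. x" k]
    external_profile_moments(2)[OF assms,
      of "\<lambda>x. (x - prob_space.expectation M (external_profile b n k))\<^sup>2" k]
  by simp

text \<open>
  Chebyshev's inequality bounds the probability by \<open>v / (\<epsilon> \<mu>)\<^sup>2\<close>; since \<open>v \<le> 3432 \<mu>\<close>, the mean can be
  replaced by the variance, which is the quantity that is known to diverge.
\<close>

lemma external_profile_relative_deviation:
  assumes M: "prob_space M" "symmetric_bits M n b" and "0 < \<epsilon>"
    and v_pos: "0 < prob_space.variance M (external_profile b n k)"
  shows "measure M {\<omega> \<in> space M.
      \<bar>external_profile b n k \<omega> / prob_space.expectation M (external_profile b n k) - 1\<bar> > \<epsilon>} \<le>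
    3432\<^sup>2 / \<epsilon>\<^sup>2 / prob_space.variance M (external_profile b n k)"
proof -
  interpret prob_space M by fact
  let ?B = "external_profile b n k"
  define \<mu> where "\<mu> = expectation ?B"
  define v where "v = variance ?B"
  have B_meas [measurable]: "?B \<in> borel_measurable M"
    by (rule external_profile_distr(1)[OF M])
  have v_le: "v \<le> 3432 * \<mu>"
    unfolding v_def \<mu>_def by (rule variance_external_profile_le[OF M])
  have "0 < v"
    using v_pos by (simp add: v_def)
  with v_le have "0 < \<mu>" by simp
  have "prob {\<omega> \<in> space M. \<bar>?B \<omega> / \<mu> - 1\<bar> > \<epsilon>} \<le> prob {\<omega> \<in> space M. \<epsilon> * \<mu> \<le> \<bar>?B \<omega> - \<mu>\<bar>}"
  proof (rule finite_measure_mono)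
    have "\<epsilon> * \<mu> \<le> \<bar>?B \<omega> - \<mu>\<bar>" if "\<bar>?B \<omega> / \<mu> - 1\<bar> > \<epsilon>" for \<omega>
    proof -
      have "?B \<omega> - \<mu> = (?B \<omega> / \<mu> - 1) * \<mu>"
        using \<open>0 < \<mu>\<close> by (simp add: field_simps)
      then have "\<bar>?B \<omega> - \<mu>\<bar> = \<bar>?B \<omega> / \<mu> - 1\<bar> * \<mu>"
        using \<open>0 < \<mu>\<close> by (simp add: abs_mult)
      then show ?thesis
        using that \<open>0 < \<mu>\<close> by simp
    qed
    then show "{\<omega> \<in> space M. \<bar>?B \<omega> / \<mu> - 1\<bar> > \<epsilon>} \<subseteq> {\<omega> \<in> space M. \<epsilon> * \<mu> \<le> \<bar>?B \<omega> - \<mu>\<bar>}"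
      by auto
  qed measurable
  also have "\<dots> \<le> v / (\<epsilon> * \<mu>)\<^sup>2"
    unfolding v_def \<mu>_def
  proof (rule Chebyshev_inequality[OF B_meas])
    show "integrable M (\<lambda>\<omega>. (?B \<omega>)\<^sup>2)"
      by (rule external_profile_moments(1)[OF M]) simp
    show "0 < \<epsilon> * expectation ?B"
      using \<open>0 < \<epsilon>\<close> \<open>0 < \<mu>\<close> by (simp add: \<mu>_def)
  qed
  also have "\<dots> \<le> 3432\<^sup>2 / \<epsilon>\<^sup>2 / v"
  proof -
    have "v * v \<le> (3432 * \<mu>) * (3432 * \<mu>)"
      using v_le \<open>0 < v\<close> by (intro mult_mono) auto
    then show ?thesis
      using \<open>0 < \<epsilon>\<close> \<open>0 < \<mu>\<close> \<open>0 < v\<close> by (simp add: field_simps power2_eq_square)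
  qed
  finally show ?thesis
    unfolding v_def \<mu>_def .
qed

theorem corollary3:
  fixes M :: "nat \<Rightarrow> 'w measure"
    and b :: "nat \<Rightarrow> nat \<Rightarrow> nat \<Rightarrow> 'w \<Rightarrow> bool"
    and k :: "nat \<Rightarrow> nat"
  assumes "\<And>n. prob_space (M n)"
    and "\<And>n. symmetric_bits (M n) n (b n)"
    and "filterlim (\<lambda>n. prob_space.variance (M n) (external_profile (b n) n (k n))) at_top sequentially"
  shows "tendsto_in_probability M
    (\<lambda>n \<omega>. external_profile (b n) n (k n) \<omega> /
      prob_space.expectation (M n) (external_profile (b n) n (k n))) 1"
  unfolding tendsto_in_probability_def
proof (intro allI impI)
  fix \<epsilon> :: real
  assume "0 < \<epsilon>"
  let ?V = "\<lambda>n. prob_space.variance (M n) (external_profile (b n) n (k n))"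
  let ?P = "\<lambda>n. measure (M n) {\<omega> \<in> space (M n). \<bar>external_profile (b n) n (k n) \<omega> /
      prob_space.expectation (M n) (external_profile (b n) n (k n)) - 1\<bar> > \<epsilon>}"
  have "eventually (\<lambda>n. 0 < ?V n) sequentially"
    using assms(3) by (simp add: filterlim_at_top_dense)
  then have "eventually (\<lambda>n. ?P n \<le> 3432\<^sup>2 / \<epsilon>\<^sup>2 / ?V n) sequentially"
    by eventually_elim (rule external_profile_relative_deviation[OF assms(1,2) \<open>0 < \<epsilon>\<close>])
  moreover have "(\<lambda>n. 3432\<^sup>2 / \<epsilon>\<^sup>2 / ?V n) \<longlonglongrightarrow> 0"
    by (rule real_tendsto_divide_at_top[OF tendsto_const assms(3)])
  ultimately show "?P \<longlonglongrightarrow> 0"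
    by (rule tendsto_sandwich[OF always_eventually _ tendsto_const, rotated 1]) simp
qed

end
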